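(* The modal logic $\mathsf{K4}$ is sound for $\Diamond_{\mathrm{ns}}$ over all topological spaces, i.e. every formula in $\mathsf{K4}$ is valid (under the $\Diamond_{\mathrm{ns}}$ semantics) on every topological space. It is complete over all infinite topological spaces, i.e. every formula valid (under the $\Diamond_{\mathrm{ns}}$ semantics) on every infinite topological space belongs to $\mathsf{K4}$.
   Context: Nonstandard setting. For a topological space $(X,\tau)$ let $S=X\cup\mathbb{R}$ and let $V(S)=\bigcup_{k\in\mathbb{N}_0}V_k(S)$ be the superstructure over $S$, where $V_0(S)=S$ and $V_{k+1}(S)=V_k(S)\cup\mathcal{P}(V_k(S))$. A polysaturated nonstandard model is a superstructure $V({}^*S)$ with a star map $A\mapsto{}^*A$ from $V(S)$ to $V({}^*S)$ such that: (1) Extension: ${}^*s=s$ for all $s\in S$; (2) Transfer: a bounded quantifier formula $\Phi(A_1,\dots,A_n)$ is true in $V(S)$ iff $\Phi({}^*A_1,\dots,{}^*A_n)$ is true in $V({}^*S)$; (3) Saturation: every family of internal sets of cardinality at most $\kappa$ with the finite intersection property has non-empty intersection, where $\kappa\ge|V(S)|$ is a fixed cardinal. A set is internal if it is an element of ${}^*C$ for some $C\in V(S)$. One such model is fixed throughout. In particular $X\subseteq{}^*X$. Halo. For $x\in X$, $\mathcal{N}(x)=\{U\in\tau: x\in U\}$ and $\mu(x)=\bigcap_{U\in\mathcal{N}(x)}{}^*U$. Modal semantics. Formulas are built from propositional variables, $\bot$, $\neg$, $\wedge$ and a unary $\Diamond$, with $\Box\varphi:=\neg\Diamond\neg\varphi$.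 A topological model is $\mathcal{M}=((X,\tau),\nu)$ with $(X,\tau)$ a topological space and $\nu$ a map from propositional variables to $\mathcal{P}(X)$. Under the $\Diamond_{\mathrm{ns}}$ semantics, the extension $\llbracket\varphi\rrbracket\subseteq X$ is defined with $\llbracket p\rrbracket=\nu(p)$, Boolean clauses as usual, and $\llbracket\Diamond\varphi\rrbracket=\llbracket\Diamond_{\mathrm{ns}}\varphi\rrbracket=\{x\in X:\mu(x)\cap({}^*\llbracket\varphi\rrbracket\setminus X)\neq\emptyset\}$. A formula is valid on $(X,\tau)$ if $\llbracket\varphi\rrbracket=X$ for every valuation $\nu$. $\mathsf{K4}$ is the set of formulas derivable from all classical tautologies and all instances of the schemas (K) $\Box(\varphi\to\psi)\to(\Box\varphi\to\Box\psi)$ and (4) $\Box\varphi\to\Box\Box\varphi$, using Modus Ponens and Necessitation.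
   Formalization: K4 is taken with the additional duality axiom ◇φ ↔ ¬□¬φ; with ◇ primitive and only tautologies, (K), (4), Modus Ponens and Necessitation, the valid formula ◇¬¬p → ◇p is not derivable, so completeness would fail. *)

theory Defs
  imports "HOL-Analysis.Abstract_Topology"
begin

unbundle cardinal_syntax

text \<open>
  HOL has no type containing all of \<open>V\<^sub>0(S), V\<^sub>1(S), \<dots>\<close> for an arbitrary \<open>S\<close>. A
  superstructure therefore lives in a type \<open>'u\<close> of entities (individuals and sets), where a
  function \<open>c :: 'u set \<Rightarrow> 'u\<close> sends a set of entities to the entity that is this set.
  Only the values of \<open>c\<close> on subsets of the levels matter.
\<close>

fun level :: "('u set \<Rightarrow> 'u) \<Rightarrow> 'u set \<Rightarrow> nat \<Rightarrow> 'u set" where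
  "level c S 0 = S"
| "level c S (Suc k) = level c S k \<union> c ` Pow (level c S k)"

definition superstructure :: "('u set \<Rightarrow> 'u) \<Rightarrow> 'u set \<Rightarrow> 'u set" where
  "superstructure c S = (\<Union>k. level c S k)"

text \<open>Distinct sets are distinct entities, and the elements of \<open>S\<close> are individuals.\<close>

definition faithful_coding :: "('u set \<Rightarrow> 'u) \<Rightarrow> 'u set \<Rightarrow> bool" where
  "faithful_coding c S \<longleftrightarrow>
     inj_on c (\<Union>k. Pow (level c S k)) \<and> c ` (\<Union>k. Pow (level c S k)) \<inter> S = {}"

definition elts :: "('u set \<Rightarrow> 'u) \<Rightarrow> 'u set \<Rightarrow> 'u \<Rightarrow> 'u set" where
  "elts c S b = {a. \<exists>k A. A \<subseteq> level c S k \<and> b = c A \<and> a \<in> A}"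

text \<open>
  Variables are natural numbers; \<open>BAll x y \<Phi>\<close> is \<open>\<forall>x \<in> y. \<Phi>\<close>, where the bound \<open>y\<close> is not in the
  scope of the quantifier. Parameters enter as values of the free variables.
\<close>

datatype bform =
    Mem nat nat
  | Eq nat nat
  | Neg bform
  | Conj bform bform
  | Disj bform bform
  | Impl bform bform
  | BAll nat nat bform
  | BEx nat nat bform

primrec bsat :: "('u set \<Rightarrow> 'u) \<Rightarrow> 'u set \<Rightarrow> (nat \<Rightarrow> 'u) \<Rightarrow> bform \<Rightarrow> bool" where
  "bsat c S \<sigma> (Mem x y) \<longleftrightarrow> \<sigma> x \<in> elts c S (\<sigma> y)"
| "bsat c S \<sigma> (Eq x y) \<longleftrightarrow> \<sigma> x = \<sigma> y"
| "bsat c S \<sigma> (Neg \<Phi>) \<longleftrightarrow> \<not> bsat c S \<sigma> \<Phi>"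
| "bsat c S \<sigma> (Conj \<Phi> \<Psi>) \<longleftrightarrow> bsat c S \<sigma> \<Phi> \<and> bsat c S \<sigma> \<Psi>"
| "bsat c S \<sigma> (Disj \<Phi> \<Psi>) \<longleftrightarrow> bsat c S \<sigma> \<Phi> \<or> bsat c S \<sigma> \<Psi>"
| "bsat c S \<sigma> (Impl \<Phi> \<Psi>) \<longleftrightarrow> (bsat c S \<sigma> \<Phi> \<longrightarrow> bsat c S \<sigma> \<Psi>)"
| "bsat c S \<sigma> (BAll x y \<Phi>) \<longleftrightarrow> (\<forall>a \<in> elts c S (\<sigma> y). bsat c S (\<sigma>(x := a)) \<Phi>)"
| "bsat c S \<sigma> (BEx x y \<Phi>) \<longleftrightarrow> (\<exists>a \<in> elts c S (\<sigma> y). bsat c S (\<sigma>(x := a)) \<Phi>)"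

text \<open>
  \<open>pt\<close> and \<open>re\<close> embed the points of the space and the reals into the entities (their ranges
  may overlap), \<open>nsbase\<close> is the set \<open>\<^sup>*S\<close>, and \<open>kappa\<close> is the saturation cardinal, given as a
  cardinal well-order.
\<close>

record ('a, 'u, 'k) nsmodel =
  pt :: "'a \<Rightarrow> 'u"
  re :: "real \<Rightarrow> 'u"
  code :: "'u set \<Rightarrow> 'u"
  star :: "'u \<Rightarrow> 'u"
  nsbase :: "'u set"
  kappa :: "'k rel"

definition base :: "'a set \<Rightarrow> ('a, 'u, 'k, 'z) nsmodel_scheme \<Rightarrow> 'u set" where
  "base X M = pt M ` X \<union> range (re M)"

abbreviation std :: "'a set \<Rightarrow> ('a, 'u, 'k, 'z) nsmodel_scheme \<Rightarrow> 'u set" where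
  "std X M \<equiv> superstructure (code M) (base X M)"

abbreviation nstd :: "('a, 'u, 'k, 'z) nsmodel_scheme \<Rightarrow> 'u set" where
  "nstd M \<equiv> superstructure (code M) (nsbase M)"

abbreviation nselts :: "('a, 'u, 'k, 'z) nsmodel_scheme \<Rightarrow> 'u \<Rightarrow> 'u set" where
  "nselts M \<equiv> elts (code M) (nsbase M)"

definition internal :: "'a set \<Rightarrow> ('a, 'u, 'k, 'z) nsmodel_scheme \<Rightarrow> 'u set" where
  "internal X M = {b. b \<notin> nsbase M \<and> (\<exists>C \<in> std X M. b \<in> nselts M (star M C))}"

locale polysaturated =
  fixes X :: "'a set" and M :: "('a, 'u, 'k) nsmodel"
  assumes inj_pt: "inj_on (pt M) X"
    and inj_re: "inj (re M)"
    and coding: "faithful_coding (code M) (base X M)"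
    and ns_coding: "faithful_coding (code M) (nsbase M)"
    and star_in: "\<And>A. A \<in> std X M \<Longrightarrow> star M A \<in> nstd M"
    and star_base: "star M (code M (base X M)) = code M (nsbase M)"
    and extension: "\<And>s. s \<in> base X M \<Longrightarrow> star M s = s"
    and transfer: "\<And>\<Phi> \<sigma>. range \<sigma> \<subseteq> std X M \<Longrightarrow>
          bsat (code M) (base X M) \<sigma> \<Phi> \<longleftrightarrow> bsat (code M) (nsbase M) (star M \<circ> \<sigma>) \<Phi>"
    and kappa_card: "Card_order (kappa M)"
    and kappa_large: "|std X M| \<le>o kappa M"
    and saturation: "\<And>F. \<lbrakk>F \<subseteq> internal X M; F \<noteq> {}; |F| \<le>o kappa M;
          \<And>G. \<lbrakk>G \<subseteq> F; finite G; G \<noteq> {}\<rbrakk> \<Longrightarrow> (\<Inter>b\<in>G. nselts M b) \<noteq> {}\<rbrakk>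
          \<Longrightarrow> (\<Inter>b\<in>F. nselts M b) \<noteq> {}"

definition nsext :: "('a, 'u, 'k, 'z) nsmodel_scheme \<Rightarrow> 'a set \<Rightarrow> 'u set" where
  "nsext M A = nselts M (star M (code M (pt M ` A)))"

definition halo :: "'a topology \<Rightarrow> ('a, 'u, 'k, 'z) nsmodel_scheme \<Rightarrow> 'a \<Rightarrow> 'u set" where
  "halo T M x = (\<Inter>U \<in> {U. openin T U \<and> x \<in> U}. nsext M U)"

datatype 'p fm =
    Var 'p
  | Falsum
  | FNot "'p fm"
  | FAnd "'p fm" "'p fm"
  | Dia "'p fm"

definition Box :: "'p fm \<Rightarrow> 'p fm" where
  "Box \<phi> = FNot (Dia (FNot \<phi>))"

definition Imp :: "'p fm \<Rightarrow> 'p fm \<Rightarrow> 'p fm" where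
  "Imp \<phi> \<psi> = FNot (FAnd \<phi> (FNot \<psi>))"

definition Iff :: "'p fm \<Rightarrow> 'p fm \<Rightarrow> 'p fm" where
  "Iff \<phi> \<psi> = FAnd (Imp \<phi> \<psi>) (Imp \<psi> \<phi>)"

primrec extent ::
  "'a topology \<Rightarrow> ('a, 'u, 'k, 'z) nsmodel_scheme \<Rightarrow> ('p \<Rightarrow> 'a set) \<Rightarrow> 'p fm \<Rightarrow> 'a set" where
  "extent T M \<nu> (Var p) = \<nu> p"
| "extent T M \<nu> Falsum = {}"
| "extent T M \<nu> (FNot \<phi>) = topspace T - extent T M \<nu> \<phi>"
| "extent T M \<nu> (FAnd \<phi> \<psi>) = extent T M \<nu> \<phi> \<inter> extent T M \<nu> \<psi>"
| "extent T M \<nu> (Dia \<phi>) =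
     {x \<in> topspace T. halo T M x \<inter> (nsext M (extent T M \<nu> \<phi>) - pt M ` topspace T) \<noteq> {}}"

definition ns_valid :: "'a topology \<Rightarrow> ('a, 'u, 'k, 'z) nsmodel_scheme \<Rightarrow> 'p fm \<Rightarrow> bool" where
  "ns_valid T M \<phi> \<longleftrightarrow>
     (\<forall>\<nu>. (\<forall>p. \<nu> p \<subseteq> topspace T) \<longrightarrow> extent T M \<nu> \<phi> = topspace T)"

text \<open>
  A classical tautology of the modal language: true under every assignment of truth values to
  the variables and to the formulas of the form \<open>Dia \<phi>\<close>, which are treated as atoms.
\<close>

primrec tval :: "('p fm \<Rightarrow> bool) \<Rightarrow> 'p fm \<Rightarrow> bool" where
  "tval v (Var p) \<longleftrightarrow> v (Var p)"
| "tval v Falsum \<longleftrightarrow> False"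
| "tval v (FNot \<phi>) \<longleftrightarrow> \<not> tval v \<phi>"
| "tval v (FAnd \<phi> \<psi>) \<longleftrightarrow> tval v \<phi> \<and> tval v \<psi>"
| "tval v (Dia \<phi>) \<longleftrightarrow> v (Dia \<phi>)"

definition tautology :: "'p fm \<Rightarrow> bool" where
  "tautology \<phi> \<longleftrightarrow> (\<forall>v. tval v \<phi>)"

text \<open>
  With \<open>Dia\<close> primitive and \<open>Box\<close> defined, the duality axiom is not redundant: the other axioms
  and rules say nothing about \<open>Dia \<phi>\<close> unless \<open>\<phi>\<close> is itself a negation, so that, for a variable \<open>p\<close>,
  \<open>Dia (FNot (FNot p)) \<rightarrow> Dia p\<close> would not be derivable. It is usually left implicit in this
  presentation of K4.
\<close>

inductive_set K4 :: "'p fm set" where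
  Taut: "tautology \<phi> \<Longrightarrow> \<phi> \<in> K4"
| Dual: "Iff (Dia \<phi>) (FNot (Box (FNot \<phi>))) \<in> K4"
| AxK: "Imp (Box (Imp \<phi> \<psi>)) (Imp (Box \<phi>) (Box \<psi>)) \<in> K4"
| Ax4: "Imp (Box \<phi>) (Box (Box \<phi>)) \<in> K4"
| MP: "\<lbrakk>\<phi> \<in> K4; Imp \<phi> \<psi> \<in> K4\<rbrakk> \<Longrightarrow> \<psi> \<in> K4"
| Nec: "\<phi> \<in> K4 \<Longrightarrow> Box \<phi> \<in> K4"

end

theory Submission
  imports Defs
begin

text \<open>
  The proof removes the nonstandard model first. For \<open>A \<subseteq> X\<close>, a point \<open>x\<close> has a point of \<open>\<^sup>*A\<close>
  outside \<open>X\<close> in its halo iff every open neighbourhood of \<open>x\<close> meets \<open>A\<close> in an infinite set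
  (\<open>halo_meets_iff\<close>): finite sets gain no points under the star map, while saturation yields a
  common point of all \<open>\<^sup>*(U \<inter> A - {y})\<close> as soon as all \<open>U \<inter> A\<close> are infinite. So \<open>Dia\<close> is read as the
  operator of \<open>\<omega>\<close>-accumulation points, and \<open>Box \<phi>\<close> holds at \<open>x\<close> iff \<open>\<phi>\<close> holds at all but
  finitely many points of some neighbourhood of \<open>x\<close>.

  Soundness is immediate from this reading. Axiom (K) holds because the intersection of two neighbourhoods
  has at most the exceptions of both, and axiom (4) because one open set witnesses \<open>Box \<phi>\<close>
  at each of its points.

  For completeness, a formula outside K4 fails in a finite transitive Kripke model
  (\<open>finite_countermodel\<close>), whose relation need not be reflexive. Every infinite type maps onto
  the finite set of worlds with all fibres infinite. The sets that are closed under passing to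
  points over an accessible world form a topology in which a point \<open>a\<close> has a least neighbourhood:
  \<open>a\<close> itself and the fibres of all accessible worlds. A union of fibres meets it in an infinite set
  iff it contains the fibre of an accessible world: the single point \<open>a\<close> does not count,
  which is why irreflexive worlds cause no difficulty. Hence the topological and the Kripke
  reading of \<open>Dia\<close> agree.
\<close>

section \<open>Eliminating the nonstandard model\<close>

lemma level_mono: "i \<le> j \<Longrightarrow> level c S i \<subseteq> level c S j"
  by (induction j) (auto simp: le_Suc_eq)

lemma elts_code:
  assumes "faithful_coding c S" "A \<subseteq> level c S k"
  shows "elts c S (c A) = A"
proof -
  have "B = A" if "B \<subseteq> level c S j" "c A = c B" for B j
    using assms that unfolding faithful_coding_def inj_on_def by blast
  then show ?thesis using assms(2) unfolding elts_def by blast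
qed

lemma code_in_superstructure: "A \<subseteq> level c S k \<Longrightarrow> c A \<in> superstructure c S"
  unfolding superstructure_def by (auto intro!: exI[of _ "Suc k"])

context polysaturated
begin

lemma base_in_std: "s \<in> base X M \<Longrightarrow> s \<in> std X M"
  unfolding superstructure_def by (auto intro!: exI[of _ 0])

lemma pt_in_base: "a \<in> X \<Longrightarrow> pt M a \<in> base X M"
  by (simp add: base_def)

lemma pt_image_level: "A \<subseteq> X \<Longrightarrow> pt M ` A \<subseteq> level (code M) (base X M) 0"
  by (auto simp: base_def)

lemma code_pt_in_std: "A \<subseteq> X \<Longrightarrow> code M (pt M ` A) \<in> std X M"
  by (rule code_in_superstructure[OF pt_image_level])

lemma elts_code_pt:
  "A \<subseteq> X \<Longrightarrow> elts (code M) (base X M) (code M (pt M ` A)) = pt M ` A"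
  by (rule elts_code[OF coding pt_image_level])

lemma transfer_Mem:
  assumes "B \<in> std X M" "C \<in> std X M"
  shows "B \<in> elts (code M) (base X M) C \<longleftrightarrow> star M B \<in> nselts M (star M C)"
proof -
  let ?s = "\<lambda>n::nat. if n = 0 then B else C"
  have "range ?s \<subseteq> std X M" using assms by (simp add: image_subset_iff)
  then have "bsat (code M) (base X M) ?s (Mem 0 1) \<longleftrightarrow>
      bsat (code M) (nsbase M) (star M \<circ> ?s) (Mem 0 1)"
    by (rule transfer)
  then show ?thesis by simp
qed

lemma pt_in_nsext_iff:
  assumes "a \<in> X" "A \<subseteq> X"
  shows "pt M a \<in> nsext M A \<longleftrightarrow> a \<in> A"
proof -
  have "pt M a \<in> pt M ` A \<longleftrightarrow> star M (pt M a) \<in> nsext M A"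
    using transfer_Mem[OF base_in_std[OF pt_in_base[OF assms(1)]] code_pt_in_std[OF assms(2)]]
    by (simp add: elts_code_pt assms nsext_def)
  then show ?thesis
    using inj_on_image_mem_iff[OF inj_pt assms] extension[OF pt_in_base[OF assms(1)]] by simp
qed

lemma nsext_Int_subset:
  assumes "A \<subseteq> X" "B \<subseteq> X" "C \<subseteq> X" "A \<inter> B \<subseteq> C"
  shows "nsext M A \<inter> nsext M B \<subseteq> nsext M C"
proof -
  let ?c = "\<lambda>A. code M (pt M ` A)"
  let ?s = "\<lambda>n::nat. if n = 1 then ?c A else if n = 2 then ?c B else ?c C"
  let ?F = "BAll 0 1 (Impl (Mem 0 2) (Mem 0 3))"
  have "pt M ` A \<inter> pt M ` B \<subseteq> pt M ` C"
    using inj_on_image_Int[OF inj_pt assms(1,2)] assms(4) by blast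
  then have "bsat (code M) (base X M) ?s ?F"
    by (auto simp: elts_code_pt[OF assms(1)] elts_code_pt[OF assms(2)] elts_code_pt[OF assms(3)])
  moreover have "range ?s \<subseteq> std X M"
    by (simp add: image_subset_iff code_pt_in_std assms)
  ultimately have "bsat (code M) (nsbase M) (star M \<circ> ?s) ?F"
    by (rule iffD1[OF transfer, rotated])
  then show ?thesis by (auto simp: nsext_def)
qed

lemma nsext_empty: "nsext M {} = {}"
proof -
  let ?F = "BAll 0 1 (Neg (Eq 0 0))"
  let ?s = "\<lambda>n::nat. code M (pt M ` {})"
  have "bsat (code M) (base X M) ?s ?F"
    using elts_code_pt[of "{}"] by simp
  moreover have "range ?s \<subseteq> std X M"
    using code_pt_in_std[of "{}"] by (simp add: image_subset_iff)
  ultimately have "bsat (code M) (nsbase M) (star M \<circ> ?s) ?F"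
    by (rule iffD1[OF transfer, rotated])
  then show ?thesis by (auto simp: nsext_def)
qed

lemma nsext_insert_subset:
  assumes "a \<in> X" "A \<subseteq> X"
  shows "nsext M (insert a A) \<subseteq> insert (pt M a) (nsext M A)"
proof -
  let ?c = "\<lambda>A. code M (pt M ` A)"
  let ?s = "\<lambda>n::nat. if n = 1 then ?c (insert a A) else if n = 2 then pt M a else ?c A"
  let ?F = "BAll 0 1 (Disj (Eq 0 2) (Mem 0 3))"
  have ia: "insert a A \<subseteq> X" using assms by simp
  have "bsat (code M) (base X M) ?s ?F"
    using elts_code_pt[OF ia] elts_code_pt[OF assms(2)] by simp
  moreover have "range ?s \<subseteq> std X M"
    using code_pt_in_std[OF ia] code_pt_in_std[OF assms(2)] base_in_std[OF pt_in_base[OF assms(1)]]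
    by (simp add: image_subset_iff)
  ultimately have "bsat (code M) (nsbase M) (star M \<circ> ?s) ?F"
    by (rule iffD1[OF transfer, rotated])
  then show ?thesis
    using extension[OF pt_in_base[OF assms(1)]] by (auto simp: nsext_def)
qed

lemma nsext_finite:
  assumes "finite A" "A \<subseteq> X"
  shows "nsext M A \<subseteq> pt M ` A"
  using assms
proof (induction A)
  case empty
  then show ?case by (simp add: nsext_empty)
next
  case (insert a A)
  then show ?case using nsext_insert_subset[of a A] by auto
qed

text \<open>
  That \<open>\<^sup>*A\<close> is not an individual is the transfer of \<open>A \<notin> S\<close>, and it is an element of \<open>\<^sup>*{A}\<close>.
\<close>

lemma star_code_pt_internal:
  assumes "A \<subseteq> X"
  shows "star M (code M (pt M ` A)) \<in> internal X M"
proof -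
  let ?B = "code M (pt M ` A)"
  have B: "?B \<in> std X M" by (rule code_pt_in_std[OF assms])
  have base0: "base X M \<subseteq> level (code M) (base X M) 0" by simp
  have "?B \<notin> base X M"
    using coding pt_image_level[OF assms] unfolding faithful_coding_def by blast
  then have "star M ?B \<notin> nselts M (star M (code M (base X M)))"
    using transfer_Mem[OF B code_in_superstructure[OF base0]] elts_code[OF coding base0] by simp
  moreover have "nselts M (star M (code M (base X M))) = nsbase M"
    using elts_code[OF ns_coding, of "nsbase M" 0] star_base by simp
  ultimately have *: "star M ?B \<notin> nsbase M" by simp
  have B1: "{?B} \<subseteq> level (code M) (base X M) 1"
    using pt_image_level[OF assms] by auto
  have "star M ?B \<in> nselts M (star M (code M {?B}))"
    using transfer_Mem[OF B code_in_superstructure[OF B1]] elts_code[OF coding B1] by simp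
  with * show ?thesis
    using code_in_superstructure[OF B1] unfolding internal_def by blast
qed

text \<open>
  Removing each standard point \<open>y\<close> from the sets makes the point given by saturation nonstandard,
  and a finite intersection of infinite sets \<open>U \<inter> A\<close>, each without one point, is nonempty because
  the neighbourhoods of \<open>x\<close> are closed under intersection. All sets in this family are images of
  standard sets, so the family is no larger than the superstructure.
\<close>

lemma halo_meets_iff:
  assumes X: "X = topspace T" and A: "A \<subseteq> X" and x: "x \<in> X"
  shows "halo T M x \<inter> (nsext M A - pt M ` X) \<noteq> {} \<longleftrightarrow>
    (\<forall>U. openin T U \<and> x \<in> U \<longrightarrow> infinite (U \<inter> A))"
proof
  assume "halo T M x \<inter> (nsext M A - pt M ` X) \<noteq> {}"
  then obtain z where z: "z \<in> halo T M x" "z \<in> nsext M A" "z \<notin> pt M ` X" by blast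
  show "\<forall>U. openin T U \<and> x \<in> U \<longrightarrow> infinite (U \<inter> A)"
  proof (intro allI impI notI)
    fix U assume U: "openin T U \<and> x \<in> U" and fin: "finite (U \<inter> A)"
    have "U \<subseteq> X" using U X openin_subset by blast
    have "z \<in> nsext M U" using z(1) U unfolding halo_def by blast
    then have "z \<in> nsext M (U \<inter> A)"
      using nsext_Int_subset[of U A "U \<inter> A"] z(2) A \<open>U \<subseteq> X\<close> by blast
    then show False using nsext_finite[OF fin] z(3) A by blast
  qed
next
  assume inf: "\<forall>U. openin T U \<and> x \<in> U \<longrightarrow> infinite (U \<inter> A)"
  define g where "g = (\<lambda>(U, y). star M (code M (pt M ` (U \<inter> A - {y}))))"
  define I where "I = {U. openin T U \<and> x \<in> U} \<times> X"
  have sub: "U \<inter> A - {y} \<subseteq> X" for U y using A by blast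
  have g_elts: "nselts M (g (U, y)) = nsext M (U \<inter> A - {y})" for U y
    by (simp add: g_def nsext_def)
  have Xx: "(X, x) \<in> I" using X x by (simp add: I_def)
  have "(\<Inter>b\<in>g ` I. nselts M b) \<noteq> {}"
  proof (rule saturation)
    show "g ` I \<subseteq> internal X M"
      using star_code_pt_internal[OF sub] by (auto simp: g_def)
    show "g ` I \<noteq> {}" using Xx by blast
    have "g ` I \<subseteq> star M ` std X M"
      using code_pt_in_std[OF sub] by (auto simp: g_def)
    then have "|g ` I| \<le>o |star M ` std X M|" by (rule card_of_mono1)
    also have "|star M ` std X M| \<le>o |std X M|" by (rule card_of_image)
    also note kappa_large
    finally show "|g ` I| \<le>o kappa M" .
  next
    fix G assume "G \<subseteq> g ` I" "finite G" "G \<noteq> {}"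
    then obtain J where J: "J \<subseteq> I" "finite J" "G = g ` J"
      by (meson finite_subset_image)
    with \<open>G \<noteq> {}\<close> have "J \<noteq> {}" by blast
    have "openin T (\<Inter>(fst ` J))"
      using J \<open>J \<noteq> {}\<close> by (intro openin_Inter) (auto simp: I_def)
    moreover have "x \<in> \<Inter>(fst ` J)" using J by (auto simp: I_def)
    ultimately have "infinite (\<Inter>(fst ` J) \<inter> A)" using inf by blast
    then have "infinite (\<Inter>(fst ` J) \<inter> A - snd ` J)"
      using J(2) Diff_infinite_finite by blast
    then obtain a where a: "a \<in> \<Inter>(fst ` J)" "a \<in> A" "a \<notin> snd ` J"
      using infinite_imp_nonempty by blast
    have "pt M a \<in> nselts M (g p)" if "p \<in> J" for p
    proof -
      obtain U y where p: "p = (U, y)" by fastforce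
      have "U \<in> fst ` J" "y \<in> snd ` J" using that p by force+
      then have "a \<in> U \<inter> A - {y}" using a by blast
      then show ?thesis
        using pt_in_nsext_iff[OF subsetD[OF A a(2)] sub, of U y] by (simp only: p g_elts)
    qed
    then show "(\<Inter>b\<in>G. nselts M b) \<noteq> {}" using J(3) by blast
  qed
  then obtain z where z_Inter: "z \<in> (\<Inter>b\<in>g ` I. nselts M b)" by blast
  have z: "z \<in> nsext M (U \<inter> A - {y})" if "(U, y) \<in> I" for U y
    using INT_D[OF z_Inter imageI[OF that]] by (simp only: g_elts)
  have mono: "nsext M B \<subseteq> nsext M C" if "B \<subseteq> C" "C \<subseteq> X" for B C
    using nsext_Int_subset[of B B C] that by blast
  have "z \<in> halo T M x"
    unfolding halo_def
  proof safe
    fix U assume U: "openin T U" "x \<in> U"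
    then have "U \<subseteq> X" using X openin_subset by blast
    then show "z \<in> nsext M U"
      using z[of U x] mono[of "U \<inter> A - {x}" U] U x by (auto simp: I_def)
  qed
  moreover have "z \<in> nsext M A"
    using z[OF Xx] mono[of "X \<inter> A - {x}" A] A by blast
  moreover have "z \<notin> pt M ` X"
  proof
    assume "z \<in> pt M ` X"
    then obtain y where y: "y \<in> X" "z = pt M y" by blast
    have "(X, y) \<in> I" using Xx y by (simp add: I_def)
    then show False using z y pt_in_nsext_iff[OF y(1) sub] by blast
  qed
  ultimately show "halo T M x \<inter> (nsext M A - pt M ` X) \<noteq> {}" by blast
qed

end

lemma extent_subset:
  assumes "\<And>p. \<nu> p \<subseteq> topspace T"
  shows "extent T M \<nu> \<phi> \<subseteq> topspace T"
  using assms by (induction \<phi>) auto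

lemma extent_Dia_iff:
  assumes "polysaturated (topspace T) M" "\<And>p. \<nu> p \<subseteq> topspace T"
  shows "x \<in> extent T M \<nu> (Dia \<phi>) \<longleftrightarrow> x \<in> topspace T \<and>
    (\<forall>U. openin T U \<and> x \<in> U \<longrightarrow> infinite (U \<inter> extent T M \<nu> \<phi>))"
proof (cases "x \<in> topspace T")
  case True
  show ?thesis
    using polysaturated.halo_meets_iff[OF assms(1) refl
        extent_subset[of \<nu> T M \<phi>, OF assms(2)] True] True
    by (simp only: extent.simps mem_Collect_eq simp_thms)
qed simp

section \<open>Soundness\<close>

lemma extent_Box_iff:
  assumes "polysaturated (topspace T) M" "\<And>p. \<nu> p \<subseteq> topspace T"
  shows "x \<in> extent T M \<nu> (Box \<phi>) \<longleftrightarrow>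
    (\<exists>U. openin T U \<and> x \<in> U \<and> finite (U - extent T M \<nu> \<phi>))"
proof -
  have "U \<inter> (topspace T - E) = U - E" if "openin T U" for U E
    using openin_subset[OF that] by blast
  then show ?thesis
    using extent_Dia_iff[OF assms, where x=x and \<phi>="FNot \<phi>"] openin_subset
    by (fastforce simp: Box_def simp del: extent.simps(5))
qed

lemma extent_Imp:
  assumes "\<And>p. \<nu> p \<subseteq> topspace T"
  shows "extent T M \<nu> (Imp \<phi> \<psi>) = (topspace T - extent T M \<nu> \<phi>) \<union> extent T M \<nu> \<psi>"
  using extent_subset[of \<nu> T M, OF assms] by (auto simp: Imp_def)

lemma extent_tval:
  assumes "\<And>p. \<nu> p \<subseteq> topspace T" "x \<in> topspace T"
  shows "x \<in> extent T M \<nu> \<phi> \<longleftrightarrow> tval (\<lambda>\<psi>. x \<in> extent T M \<nu> \<psi>) \<phi>"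
  using assms(2) by (induction \<phi>) auto

lemma K4_sound:
  assumes M: "polysaturated (topspace T) M" and \<nu>: "\<And>p. \<nu> p \<subseteq> topspace T" and "\<phi> \<in> K4"
  shows "topspace T \<subseteq> extent T M \<nu> \<phi>"
proof -
  have Box_iff: "x \<in> extent T M \<nu> (Box \<phi>) \<longleftrightarrow>
      (\<exists>U. openin T U \<and> x \<in> U \<and> finite (U - extent T M \<nu> \<phi>))" for x \<phi>
    using M \<nu> by (rule extent_Box_iff)
  show ?thesis using \<open>\<phi> \<in> K4\<close>
  proof induction
    case (Taut \<phi>)
    then show ?case using extent_tval[of \<nu> T, OF \<nu>] by (auto simp: tautology_def)
  next
    case (Dual \<phi>)
    have "topspace T - (topspace T - extent T M \<nu> \<phi>) = extent T M \<nu> \<phi>"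
      using extent_subset[of \<nu> T M, OF \<nu>] by blast
    then have *: "extent T M \<nu> (Dia (FNot (FNot \<phi>))) = extent T M \<nu> (Dia \<phi>)"
      by (simp only: extent.simps)
    show ?case
    proof
      fix x assume "x \<in> topspace T"
      moreover have "tval (\<lambda>\<psi>. x \<in> extent T M \<nu> \<psi>) (Iff (Dia \<phi>) (FNot (Box (FNot \<phi>))))"
        unfolding Iff_def Box_def Imp_def tval.simps * by blast
      ultimately show "x \<in> extent T M \<nu> (Iff (Dia \<phi>) (FNot (Box (FNot \<phi>))))"
        using extent_tval[of \<nu> T, OF \<nu>] by blast
    qed
  next
    case (AxK \<phi> \<psi>)
    have "x \<in> extent T M \<nu> (Box \<psi>)"
      if imp: "x \<in> extent T M \<nu> (Box (Imp \<phi> \<psi>))" and phi: "x \<in> extent T M \<nu> (Box \<phi>)" for x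
    proof -
      obtain U where U: "openin T U" "x \<in> U" "finite (U - extent T M \<nu> (Imp \<phi> \<psi>))"
        using imp by (auto simp only: Box_iff)
      obtain V where V: "openin T V" "x \<in> V" "finite (V - extent T M \<nu> \<phi>)"
        using phi by (auto simp only: Box_iff)
      have "(U \<inter> V) - extent T M \<nu> \<psi> \<subseteq>
          (U - extent T M \<nu> (Imp \<phi> \<psi>)) \<union> (V - extent T M \<nu> \<phi>)"
        by (auto simp: extent_Imp[of \<nu> T, OF \<nu>])
      then have "finite ((U \<inter> V) - extent T M \<nu> \<psi>)"
        using U(3) V(3) finite_subset by blast
      then show ?thesis
        unfolding Box_iff using openin_Int[OF U(1) V(1)] U(2) V(2) by blast
    qed
    then show ?case by (auto simp: extent_Imp[of \<nu> T, OF \<nu>])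
  next
    case (Ax4 \<phi>)
    have "x \<in> extent T M \<nu> (Box (Box \<phi>))" if box: "x \<in> extent T M \<nu> (Box \<phi>)" for x
    proof -
      obtain U where U: "openin T U" "x \<in> U" "finite (U - extent T M \<nu> \<phi>)"
        using box by (auto simp only: Box_iff)
      then have "y \<in> extent T M \<nu> (Box \<phi>)" if "y \<in> U" for y
        unfolding Box_iff using that by blast
      then have "U - extent T M \<nu> (Box \<phi>) = {}" by blast
      then show ?thesis
        unfolding Box_iff[of x "Box \<phi>"] using U by (metis finite.emptyI)
    qed
    then show ?case by (auto simp: extent_Imp[of \<nu> T, OF \<nu>])
  next
    case (MP \<phi> \<psi>)
    then show ?case by (auto simp: extent_Imp[of \<nu> T, OF \<nu>])
  next
    case (Nec \<phi>)
    then have "topspace T - extent T M \<nu> \<phi> = {}" by blast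
    then have "x \<in> extent T M \<nu> (Box \<phi>)" if "x \<in> topspace T" for x
      unfolding Box_iff using that by (metis finite.emptyI openin_topspace)
    then show ?case by blast
  qed
qed

section \<open>Derivations in K4\<close>

lemma tval_Imp [simp]: "tval v (Imp \<phi> \<psi>) \<longleftrightarrow> (tval v \<phi> \<longrightarrow> tval v \<psi>)"
  by (simp add: Imp_def)

lemma tval_Iff [simp]: "tval v (Iff \<phi> \<psi>) \<longleftrightarrow> (tval v \<phi> \<longleftrightarrow> tval v \<psi>)"
  by (auto simp: Iff_def)

text \<open>
  All propositional reasoning inside K4 goes through this rule, which turns it into reasoning
  about truth values.
\<close>

lemma K4_consequence:
  assumes "set \<Gamma> \<subseteq> K4" "\<And>v. \<forall>\<gamma>\<in>set \<Gamma>. tval v \<gamma> \<Longrightarrow> tval v \<phi>"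
  shows "\<phi> \<in> K4"
  using assms
proof (induction \<Gamma> arbitrary: \<phi>)
  case Nil
  then show ?case by (auto intro: K4.Taut simp: tautology_def)
next
  case (Cons \<gamma> \<Gamma>)
  have "Imp \<gamma> \<phi> \<in> K4" using Cons.prems by (intro Cons.IH) auto
  then show ?case using Cons.prems(1) K4.MP by auto
qed

lemma Box_mono:
  assumes "Imp \<phi> \<psi> \<in> K4"
  shows "Imp (Box \<phi>) (Box \<psi>) \<in> K4"
  using K4.MP[OF K4.Nec[OF assms] K4.AxK] .

lemma Box_mono2:
  assumes "Imp \<phi> (Imp \<psi> \<chi>) \<in> K4"
  shows "Imp (Box \<phi>) (Imp (Box \<psi>) (Box \<chi>)) \<in> K4"
  by (rule K4_consequence[of "[Imp (Box \<phi>) (Box (Imp \<psi> \<chi>)),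
        Imp (Box (Imp \<psi> \<chi>)) (Imp (Box \<psi>) (Box \<chi>))]"])
    (auto intro: Box_mono assms K4.AxK)

lemma Box_mono3:
  assumes "Imp \<phi> (Imp \<psi> (Imp \<chi> \<theta>)) \<in> K4"
  shows "Imp (Box \<phi>) (Imp (Box \<psi>) (Imp (Box \<chi>) (Box \<theta>))) \<in> K4"
  by (rule K4_consequence[of "[Imp (Box \<phi>) (Imp (Box \<psi>) (Box (Imp \<chi> \<theta>))),
        Imp (Box (Imp \<chi> \<theta>)) (Imp (Box \<chi>) (Box \<theta>))]"])
    (auto intro: Box_mono2 assms K4.AxK)

lemma not_Dia_imp_Box_not_Dia: "Imp (FNot (Dia \<chi>)) (Box (FNot (Dia \<chi>))) \<in> K4"
proof -
  have "Imp (Box (FNot \<chi>)) (FNot (Dia \<chi>)) \<in> K4"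
    by (rule K4_consequence[of "[Iff (Dia \<chi>) (FNot (Box (FNot \<chi>)))]"]) (auto intro: K4.Dual)
  then have "Imp (Box (Box (FNot \<chi>))) (Box (FNot (Dia \<chi>))) \<in> K4" by (rule Box_mono)
  then show ?thesis
    by (intro K4_consequence[of "[Imp (Box (Box (FNot \<chi>))) (Box (FNot (Dia \<chi>))),
          Imp (Box (FNot \<chi>)) (Box (Box (FNot \<chi>))), Iff (Dia \<chi>) (FNot (Box (FNot \<chi>)))]"])
      (auto intro: K4.Dual K4.Ax4)
qed

text \<open>
  By distributivity, \<open>Dia \<psi>\<close> implies \<open>Dia (\<psi> \<and> \<not> \<chi> \<and> \<not> Dia \<chi>) \<or> Dia \<chi> \<or> Dia (Dia \<chi>)\<close>, and
  transitivity reduces the last disjunct to the second. So a \<open>\<psi>\<close>-successor of a world that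
  refutes \<open>Dia \<chi>\<close> may be assumed to refute \<open>\<chi>\<close> and \<open>Dia \<chi>\<close>.
\<close>

lemma Dia_restrict:
  "Imp (Dia \<psi>) (Imp (FNot (Dia \<chi>)) (Dia (FAnd \<psi> (FAnd (FNot \<chi>) (FNot (Dia \<chi>)))))) \<in> K4"
proof -
  let ?r = "FAnd \<psi> (FAnd (FNot \<chi>) (FNot (Dia \<chi>)))"
  have "Imp (FNot ?r) (Imp (FNot \<chi>) (Imp (FNot (Dia \<chi>)) (FNot \<psi>))) \<in> K4"
    by (rule K4_consequence[of "[]"]) auto
  note b = Box_mono3[OF this]
  show ?thesis
    by (rule K4_consequence[of "[Imp (Box (FNot ?r)) (Imp (Box (FNot \<chi>))
          (Imp (Box (FNot (Dia \<chi>))) (Box (FNot \<psi>)))), Imp (FNot (Dia \<chi>)) (Box (FNot (Dia \<chi>))),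
          Iff (Dia \<chi>) (FNot (Box (FNot \<chi>))), Iff (Dia \<psi>) (FNot (Box (FNot \<psi>))),
          Iff (Dia ?r) (FNot (Box (FNot ?r)))]"])
      (auto intro: b K4.Dual not_Dia_imp_Box_not_Dia simp del: tval.simps(5))
qed

section \<open>A finite transitive countermodel\<close>

definition consistent :: "'p fm \<Rightarrow> bool" where
  "consistent \<theta> \<longleftrightarrow> FNot \<theta> \<notin> K4"

definition decides :: "'p fm \<Rightarrow> 'p fm set \<Rightarrow> bool" where
  "decides \<theta> G \<longleftrightarrow> (\<forall>\<psi>\<in>G. Imp \<theta> \<psi> \<in> K4 \<or> Imp \<theta> (FNot \<psi>) \<in> K4)"

lemma consistent_not_both:
  assumes "consistent \<theta>" "Imp \<theta> \<psi> \<in> K4"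
  shows "Imp \<theta> (FNot \<psi>) \<notin> K4"
proof
  assume "Imp \<theta> (FNot \<psi>) \<in> K4"
  then have "FNot \<theta> \<in> K4"
    by (intro K4_consequence[of "[Imp \<theta> \<psi>, Imp \<theta> (FNot \<psi>)]"]) (use assms(2) in auto)
  then show False using assms(1) by (simp add: consistent_def)
qed

lemma Imp_trans_K4: "Imp \<phi> \<psi> \<in> K4 \<Longrightarrow> Imp \<psi> \<chi> \<in> K4 \<Longrightarrow> Imp \<phi> \<chi> \<in> K4"
  by (rule K4_consequence[of "[Imp \<phi> \<psi>, Imp \<psi> \<chi>]"]) auto

text \<open>
  A finite form of Lindenbaum's lemma. A single consistent formula that decides \<open>G\<close> plays the role
  of a maximal consistent subset of \<open>G\<close>.
\<close>

lemma consistent_decides: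
  assumes "finite G" "consistent \<theta>"
  shows "\<exists>\<theta>'. consistent \<theta>' \<and> Imp \<theta>' \<theta> \<in> K4 \<and> decides \<theta>' G"
  using assms(1)
proof induction
  case empty
  have "Imp \<theta> \<theta> \<in> K4" by (rule K4_consequence[of "[]"]) auto
  then show ?case using assms(2) by (auto simp: decides_def)
next
  case (insert \<psi> G)
  then obtain \<theta>' where \<theta>': "consistent \<theta>'" "Imp \<theta>' \<theta> \<in> K4" "decides \<theta>' G" by blast
  have "consistent (FAnd \<theta>' \<psi>) \<or> consistent (FAnd \<theta>' (FNot \<psi>))"
  proof (rule ccontr)
    assume "\<not> ?thesis"
    then have "FNot \<theta>' \<in> K4"
      by (intro K4_consequence[of "[FNot (FAnd \<theta>' \<psi>), FNot (FAnd \<theta>' (FNot \<psi>))]"])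
        (auto simp: consistent_def)
    then show False using \<theta>'(1) by (simp add: consistent_def)
  qed
  then obtain \<psi>' where \<psi>': "\<psi>' = \<psi> \<or> \<psi>' = FNot \<psi>" "consistent (FAnd \<theta>' \<psi>')" by blast
  have l: "Imp (FAnd \<theta>' \<psi>') \<theta>' \<in> K4" and r: "Imp (FAnd \<theta>' \<psi>') \<psi>' \<in> K4"
    by (rule K4_consequence[of "[]"]; auto)+
  have "decides (FAnd \<theta>' \<psi>') (insert \<psi> G)"
    using \<theta>'(3) \<psi>'(1) r Imp_trans_K4[OF l] unfolding decides_def by blast
  then show ?case using \<psi>'(2) Imp_trans_K4[OF l \<theta>'(2)] by blast
qed

lemma consistent_Dia_restrict:
  assumes "finite D" "consistent \<theta>" "Imp \<theta> (Dia \<psi>) \<in> K4"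
    "\<And>\<chi>. \<chi> \<in> D \<Longrightarrow> Imp \<theta> (FNot (Dia \<chi>)) \<in> K4"
  shows "\<exists>\<eta>. consistent \<eta> \<and> Imp \<eta> \<psi> \<in> K4 \<and>
    (\<forall>\<chi>\<in>D. Imp \<eta> (FNot \<chi>) \<in> K4 \<and> Imp \<eta> (FNot (Dia \<chi>)) \<in> K4)"
proof -
  have "\<exists>\<eta>. Imp \<theta> (Dia \<eta>) \<in> K4 \<and> Imp \<eta> \<psi> \<in> K4 \<and>
    (\<forall>\<chi>\<in>D. Imp \<eta> (FNot \<chi>) \<in> K4 \<and> Imp \<eta> (FNot (Dia \<chi>)) \<in> K4)"
    using assms(1,4)
  proof induction
    case empty
    have "Imp \<psi> \<psi> \<in> K4" by (rule K4_consequence[of "[]"]) auto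
    then show ?case using assms(3) by auto
  next
    case (insert \<chi> D)
    then obtain \<eta> where \<eta>: "Imp \<theta> (Dia \<eta>) \<in> K4" "Imp \<eta> \<psi> \<in> K4"
      "\<forall>\<chi>\<in>D. Imp \<eta> (FNot \<chi>) \<in> K4 \<and> Imp \<eta> (FNot (Dia \<chi>)) \<in> K4" by auto
    let ?r = "FAnd \<eta> (FAnd (FNot \<chi>) (FNot (Dia \<chi>)))"
    have "Imp \<theta> (FNot (Dia \<chi>)) \<in> K4" using insert.prems by blast
    then have "Imp \<theta> (Dia ?r) \<in> K4"
      by (intro K4_consequence[of "[Imp \<theta> (Dia \<eta>), Imp \<theta> (FNot (Dia \<chi>)),
            Imp (Dia \<eta>) (Imp (FNot (Dia \<chi>)) (Dia ?r))]"])
        (use \<eta>(1) Dia_restrict[of \<eta> \<chi>] in auto)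
    moreover have l: "Imp ?r \<eta> \<in> K4" and "Imp ?r (FNot \<chi>) \<in> K4"
      and "Imp ?r (FNot (Dia \<chi>)) \<in> K4"
      by (rule K4_consequence[of "[]"]; auto)+
    ultimately show ?case using \<eta>(2,3) Imp_trans_K4[OF l] by blast
  qed
  then obtain \<eta> where \<eta>: "Imp \<theta> (Dia \<eta>) \<in> K4" "Imp \<eta> \<psi> \<in> K4"
    "\<forall>\<chi>\<in>D. Imp \<eta> (FNot \<chi>) \<in> K4 \<and> Imp \<eta> (FNot (Dia \<chi>)) \<in> K4" by blast
  have "consistent \<eta>"
    unfolding consistent_def
  proof
    assume "FNot \<eta> \<in> K4"
    then have "Box (FNot \<eta>) \<in> K4" by (rule K4.Nec)
    then have "Imp \<theta> (FNot (Dia \<eta>)) \<in> K4"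
      by (intro K4_consequence[of "[Box (FNot \<eta>), Iff (Dia \<eta>) (FNot (Box (FNot \<eta>)))]"])
        (auto intro: K4.Dual)
    then show False using consistent_not_both[OF assms(2) \<eta>(1)] by blast
  qed
  with \<eta>(2,3) show ?thesis by blast
qed

primrec subfms :: "'p fm \<Rightarrow> 'p fm set" where
  "subfms (Var p) = {Var p}"
| "subfms Falsum = {Falsum}"
| "subfms (FNot \<phi>) = insert (FNot \<phi>) (subfms \<phi>)"
| "subfms (FAnd \<phi> \<psi>) = insert (FAnd \<phi> \<psi>) (subfms \<phi> \<union> subfms \<psi>)"
| "subfms (Dia \<phi>) = insert (Dia \<phi>) (subfms \<phi>)"

lemma finite_subfms: "finite (subfms \<phi>)"
  by (induction \<phi>) auto

lemma subfms_refl: "\<phi> \<in> subfms \<phi>"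
  by (cases \<phi>) auto

primrec ksat :: "'w set \<Rightarrow> ('w \<Rightarrow> 'w \<Rightarrow> bool) \<Rightarrow> ('w \<Rightarrow> 'p \<Rightarrow> bool) \<Rightarrow> 'p fm \<Rightarrow> 'w \<Rightarrow> bool" where
  "ksat W R V (Var p) w \<longleftrightarrow> V w p"
| "ksat W R V Falsum w \<longleftrightarrow> False"
| "ksat W R V (FNot \<phi>) w \<longleftrightarrow> \<not> ksat W R V \<phi> w"
| "ksat W R V (FAnd \<phi> \<psi>) w \<longleftrightarrow> ksat W R V \<phi> w \<and> ksat W R V \<psi> w"
| "ksat W R V (Dia \<phi>) w \<longleftrightarrow> (\<exists>v\<in>W. R w v \<and> ksat W R V \<phi> v)"

text \<open>
  The worlds are the sets of subformulas of \<open>\<phi>\<close> that follow from a consistent formula deciding all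
  of them, so there are finitely many. Mentioning \<open>Dia \<chi>\<close> besides \<open>\<chi>\<close> in the accessibility relation makes
  it transitive; the price is that successors must refute \<open>Dia \<chi>\<close> as well, and
  \<open>consistent_Dia_restrict\<close> provides such successors.
\<close>

lemma finite_countermodel:
  fixes \<phi> :: "'p fm"
  assumes "\<phi> \<notin> K4"
  shows "\<exists>(W :: 'p fm set set) R V w. finite W \<and> (\<forall>u v x. R u v \<longrightarrow> R v x \<longrightarrow> R u x) \<and>
    w \<in> W \<and> \<not> ksat W R V \<phi> w"
proof -
  define G where "G = subfms \<phi>"
  define world where "world = (\<lambda>\<theta>. {\<psi> \<in> G. Imp \<theta> \<psi> \<in> K4})"
  define W where "W = world ` {\<theta>. consistent \<theta> \<and> decides \<theta> G}"
  define R :: "'p fm set \<Rightarrow> 'p fm set \<Rightarrow> bool" where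
    "R = (\<lambda>w v. \<forall>\<chi>. Dia \<chi> \<in> G \<longrightarrow> \<chi> \<in> v \<or> Dia \<chi> \<in> v \<longrightarrow> Dia \<chi> \<in> w)"
  define V :: "'p fm set \<Rightarrow> 'p \<Rightarrow> bool" where "V = (\<lambda>w p. Var p \<in> w)"
  have finG: "finite G" by (simp add: G_def finite_subfms)
  have "W \<subseteq> Pow G" by (auto simp: W_def world_def)
  then have finW: "finite W" using finG finite_subset by blast
  have trans: "R u x" if "R u v" "R v x" for u v x
    using that unfolding R_def by blast
  have notin: "\<psi> \<notin> world \<theta> \<longleftrightarrow> Imp \<theta> (FNot \<psi>) \<in> K4"
    if "consistent \<theta>" "decides \<theta> G" "\<psi> \<in> G" for \<theta> \<psi>
    using that consistent_not_both[of \<theta> \<psi>] by (auto simp: world_def decides_def)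
  have truth: "ksat W R V \<psi> w \<longleftrightarrow> \<psi> \<in> w" if "subfms \<psi> \<subseteq> G" "w \<in> W" for \<psi> w
    using that
  proof (induction \<psi> arbitrary: w)
    case (Var p)
    then show ?case by (simp add: V_def)
  next
    case Falsum
    then obtain \<theta> where \<theta>: "w = world \<theta>" "consistent \<theta>" by (auto simp: W_def)
    have "Imp \<theta> Falsum \<notin> K4"
    proof
      assume "Imp \<theta> Falsum \<in> K4"
      then have "FNot \<theta> \<in> K4" by (intro K4_consequence[of "[Imp \<theta> Falsum]"]) auto
      then show False using \<theta>(2) by (simp add: consistent_def)
    qed
    then show ?case using \<theta>(1) by (simp add: world_def)
  next
    case (FNot \<psi>)
    then obtain \<theta> where \<theta>: "w = world \<theta>" "consistent \<theta>" "decides \<theta> G" by (auto simp: W_def)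
    have "\<psi> \<in> G" "FNot \<psi> \<in> G" using FNot.prems(1) subfms_refl[of \<psi>] by auto
    then have "FNot \<psi> \<in> w \<longleftrightarrow> \<psi> \<notin> w" using notin[OF \<theta>(2,3)] \<theta>(1) by (simp add: world_def)
    then show ?case using FNot by simp
  next
    case (FAnd \<psi> \<chi>)
    then obtain \<theta> where \<theta>: "w = world \<theta>" by (auto simp: W_def)
    have "Imp \<theta> (FAnd \<psi> \<chi>) \<in> K4 \<longleftrightarrow> Imp \<theta> \<psi> \<in> K4 \<and> Imp \<theta> \<chi> \<in> K4"
    proof (intro iffI conjI)
      assume a: "Imp \<theta> (FAnd \<psi> \<chi>) \<in> K4"
      show "Imp \<theta> \<psi> \<in> K4" "Imp \<theta> \<chi> \<in> K4"
        by (rule K4_consequence[of "[Imp \<theta> (FAnd \<psi> \<chi>)]"]; use a in auto)+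
    next
      assume a: "Imp \<theta> \<psi> \<in> K4 \<and> Imp \<theta> \<chi> \<in> K4"
      show "Imp \<theta> (FAnd \<psi> \<chi>) \<in> K4"
        by (rule K4_consequence[of "[Imp \<theta> \<psi>, Imp \<theta> \<chi>]"]) (use a in auto)
    qed
    then have "FAnd \<psi> \<chi> \<in> w \<longleftrightarrow> \<psi> \<in> w \<and> \<chi> \<in> w"
      using \<theta> FAnd.prems(1) subfms_refl[of \<psi>] subfms_refl[of \<chi>] by (auto simp: world_def)
    then show ?case using FAnd by simp
  next
    case (Dia \<psi>)
    then obtain \<theta> where \<theta>: "w = world \<theta>" "consistent \<theta>" "decides \<theta> G" by (auto simp: W_def)
    have \<psi>G: "\<psi> \<in> G" "Dia \<psi> \<in> G" using Dia.prems(1) subfms_refl[of \<psi>] by auto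
    have "(\<exists>v\<in>W. R w v \<and> \<psi> \<in> v) \<longleftrightarrow> Dia \<psi> \<in> w"
    proof
      assume "\<exists>v\<in>W. R w v \<and> \<psi> \<in> v"
      then show "Dia \<psi> \<in> w" using \<psi>G by (auto simp: R_def)
    next
      assume "Dia \<psi> \<in> w"
      then have d: "Imp \<theta> (Dia \<psi>) \<in> K4" using \<theta> by (simp add: world_def)
      define D where "D = {\<chi>. Dia \<chi> \<in> G \<and> Dia \<chi> \<notin> w}"
      have "inj Dia" by (simp add: inj_def)
      then have "finite (Dia -` G)" using finG by (rule finite_vimageI[rotated])
      then have "finite D" by (rule finite_subset[rotated]) (auto simp: D_def)
      moreover have "Imp \<theta> (FNot (Dia \<chi>)) \<in> K4" if "\<chi> \<in> D" for \<chi>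
        using that notin[OF \<theta>(2,3), of "Dia \<chi>"] \<theta>(1) by (simp add: D_def)
      ultimately obtain \<eta> where \<eta>: "consistent \<eta>" "Imp \<eta> \<psi> \<in> K4"
        "\<forall>\<chi>\<in>D. Imp \<eta> (FNot \<chi>) \<in> K4 \<and> Imp \<eta> (FNot (Dia \<chi>)) \<in> K4"
        using consistent_Dia_restrict[OF _ \<theta>(2) d] by blast
      obtain \<theta>' where \<theta>': "consistent \<theta>'" "Imp \<theta>' \<eta> \<in> K4" "decides \<theta>' G"
        using consistent_decides[OF finG \<eta>(1)] by blast
      have "\<psi> \<in> world \<theta>'" using \<psi>G Imp_trans_K4[OF \<theta>'(2) \<eta>(2)] by (simp add: world_def)
      moreover have "\<chi> \<notin> world \<theta>'" "Dia \<chi> \<notin> world \<theta>'" if "\<chi> \<in> D" for \<chi>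
        using that \<eta>(3) Imp_trans_K4[OF \<theta>'(2)] consistent_not_both[OF \<theta>'(1)]
        by (auto simp: world_def)
      then have "R w (world \<theta>')" by (auto simp: R_def D_def)
      moreover have "world \<theta>' \<in> W" using \<theta>' by (auto simp: W_def)
      ultimately show "\<exists>v\<in>W. R w v \<and> \<psi> \<in> v" by blast
    qed
    then show ?case using Dia by auto
  qed
  have "consistent (FNot \<phi>)"
    unfolding consistent_def
  proof
    assume "FNot (FNot \<phi>) \<in> K4"
    then have "\<phi> \<in> K4" by (intro K4_consequence[of "[FNot (FNot \<phi>)]"]) auto
    then show False using assms by blast
  qed
  then obtain \<theta> where \<theta>: "consistent \<theta>" "Imp \<theta> (FNot \<phi>) \<in> K4" "decides \<theta> G"
    using consistent_decides[OF finG] by blast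
  have "\<phi> \<notin> world \<theta>" using notin[OF \<theta>(1,3)] \<theta>(2) by (simp add: G_def subfms_refl)
  moreover have "world \<theta> \<in> W" using \<theta> by (auto simp: W_def)
  ultimately have "\<not> ksat W R V \<phi> (world \<theta>)" using truth[of \<phi>] by (simp add: G_def)
  with finW trans \<open>world \<theta> \<in> W\<close> show ?thesis by blast
qed

section \<open>Spreading a finite model over an infinite space\<close>

lemma infinite_fibre_map:
  assumes "infinite (UNIV :: 'a set)" "finite W" "W \<noteq> {}"
  shows "\<exists>\<pi> :: 'a \<Rightarrow> 'w. range \<pi> \<subseteq> W \<and> (\<forall>w\<in>W. infinite (\<pi> -` {w}))"
proof -
  obtain f :: "nat \<Rightarrow> 'a" where f: "inj f"
    using infinite_countable_subset[OF assms(1)] by blast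
  define n where "n = card W"
  have n: "n > 0" using assms by (simp add: n_def card_gt_0_iff)
  obtain e where e: "bij_betw e {0..<n} W"
    using ex_bij_betw_nat_finite[OF assms(2)] by (auto simp: n_def)
  define \<pi> where "\<pi> = (\<lambda>a. e (inv f a mod n))"
  have "range \<pi> \<subseteq> W" using e n by (auto simp: \<pi>_def bij_betw_def)
  moreover have "infinite (\<pi> -` {w})" if "w \<in> W" for w
  proof -
    have "w \<in> e ` {0..<n}" using e that by (simp add: bij_betw_def)
    then obtain i where i: "i < n" "w = e i" by auto
    have "inj (\<lambda>k. f (k * n + i))"
      using n by (intro injI) (auto dest!: injD[OF f])
    moreover have "range (\<lambda>k. f (k * n + i)) \<subseteq> \<pi> -` {w}"
      using f i by (auto simp: \<pi>_def)
    ultimately show ?thesis using finite_subset range_inj_infinite by blast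
  qed
  ultimately show ?thesis by blast
qed

definition spread_topology :: "('a \<Rightarrow> 'w) \<Rightarrow> ('w \<Rightarrow> 'w \<Rightarrow> bool) \<Rightarrow> 'a topology" where
  "spread_topology \<pi> R = topology (\<lambda>U. \<forall>a\<in>U. \<forall>b. R (\<pi> a) (\<pi> b) \<longrightarrow> b \<in> U)"

lemma openin_spread:
  "openin (spread_topology \<pi> R) U \<longleftrightarrow> (\<forall>a\<in>U. \<forall>b. R (\<pi> a) (\<pi> b) \<longrightarrow> b \<in> U)"
proof -
  have "istopology (\<lambda>U. \<forall>a\<in>U. \<forall>b. R (\<pi> a) (\<pi> b) \<longrightarrow> b \<in> U)"
    unfolding istopology_def by blast
  then show ?thesis by (simp add: spread_topology_def topology_inverse')
qed

lemma topspace_spread: "topspace (spread_topology \<pi> R) = UNIV"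
  using openin_subset[of "spread_topology \<pi> R" UNIV] by (auto simp: openin_spread)

lemma extent_spread:
  assumes M: "polysaturated (topspace (spread_topology \<pi> R)) M"
    and trans: "\<forall>u v x. R u v \<longrightarrow> R v x \<longrightarrow> R u x"
    and W: "range \<pi> \<subseteq> W" "\<forall>w\<in>W. infinite (\<pi> -` {w})"
  shows "extent (spread_topology \<pi> R) M (\<lambda>p. {a. V (\<pi> a) p}) \<phi> = {a. ksat W R V \<phi> (\<pi> a)}"
proof (induction \<phi>)
  case (Dia \<phi>)
  let ?T = "spread_topology \<pi> R" and ?\<nu> = "\<lambda>p. {a. V (\<pi> a) p}"
  let ?A = "{a. ksat W R V \<phi> (\<pi> a)}"
  have "a \<in> extent ?T M ?\<nu> (Dia \<phi>) \<longleftrightarrow> (\<exists>v\<in>W. R (\<pi> a) v \<and> ksat W R V \<phi> v)" for a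
  proof -
    have "a \<in> extent ?T M ?\<nu> (Dia \<phi>) \<longleftrightarrow> (\<forall>U. openin ?T U \<and> a \<in> U \<longrightarrow> infinite (U \<inter> ?A))"
      using extent_Dia_iff[OF M, where \<nu>="?\<nu>" and x=a and \<phi>=\<phi>] Dia by (simp add: topspace_spread del: extent.simps)
    also have "\<dots> \<longleftrightarrow> (\<exists>v\<in>W. R (\<pi> a) v \<and> ksat W R V \<phi> v)"
    proof
      assume inf: "\<forall>U. openin ?T U \<and> a \<in> U \<longrightarrow> infinite (U \<inter> ?A)"
      let ?U = "insert a {b. R (\<pi> a) (\<pi> b)}"
      have "openin ?T ?U" using trans unfolding openin_spread by blast
      then have "infinite (?U \<inter> ?A)" using inf by blast
      \<comment> \<open>The neighbourhood contains \<open>a\<close> even if \<open>\<pi> a\<close> is irreflexive, so one point is not enough.\<close>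
      then have "infinite (?U \<inter> ?A - {a})" by simp
      then obtain b where "b \<in> ?U \<inter> ?A - {a}" by (metis finite.emptyI ex_in_conv)
      then show "\<exists>v\<in>W. R (\<pi> a) v \<and> ksat W R V \<phi> v" using W(1) by blast
    next
      assume "\<exists>v\<in>W. R (\<pi> a) v \<and> ksat W R V \<phi> v"
      then obtain v where v: "v \<in> W" "R (\<pi> a) v" "ksat W R V \<phi> v" by blast
      show "\<forall>U. openin ?T U \<and> a \<in> U \<longrightarrow> infinite (U \<inter> ?A)"
      proof (intro allI impI)
        fix U assume "openin ?T U \<and> a \<in> U"
        then have "\<pi> -` {v} \<subseteq> U \<inter> ?A" using v unfolding openin_spread by blast
        then show "infinite (U \<inter> ?A)" using W(2) v(1) finite_subset by blast
      qed
    qed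
    finally show ?thesis .
  qed
  then show ?case by (auto simp del: extent.simps)
qed (auto simp: topspace_spread)

theorem theorem6p16:
  fixes M :: "'a topology \<Rightarrow> ('a, 'u, 'k) nsmodel"
  assumes "\<And>T. polysaturated (topspace T) (M T)"
  shows "(\<forall>\<phi> :: 'p fm. \<phi> \<in> K4 \<longrightarrow> (\<forall>T. ns_valid T (M T) \<phi>)) \<and>
    (infinite (UNIV :: 'a set) \<longrightarrow>
      (\<forall>\<phi> :: 'p fm. (\<forall>T. infinite (topspace T) \<longrightarrow> ns_valid T (M T) \<phi>) \<longrightarrow> \<phi> \<in> K4))"
proof (intro conjI allI impI)
  fix \<phi> :: "'p fm" and T assume "\<phi> \<in> K4"
  show "ns_valid T (M T) \<phi>"
    unfolding ns_valid_def
  proof (intro allI impI equalityI)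
    fix \<nu> :: "'p \<Rightarrow> 'a set" assume "\<forall>p. \<nu> p \<subseteq> topspace T"
    then have \<nu>: "\<And>p. \<nu> p \<subseteq> topspace T" by blast
    show "extent T (M T) \<nu> \<phi> \<subseteq> topspace T" using \<nu> by (rule extent_subset)
    show "topspace T \<subseteq> extent T (M T) \<nu> \<phi>" using assms \<nu> \<open>\<phi> \<in> K4\<close> by (rule K4_sound)
  qed
next
  fix \<phi> :: "'p fm"
  assume inf: "infinite (UNIV :: 'a set)"
    and valid: "\<forall>T. infinite (topspace T) \<longrightarrow> ns_valid T (M T) \<phi>"
  show "\<phi> \<in> K4"
  proof (rule ccontr)
    assume "\<phi> \<notin> K4"
    then obtain W R V w where W: "finite (W :: 'p fm set set)" "w \<in> W"
      and trans: "\<forall>u v x. R u v \<longrightarrow> R v x \<longrightarrow> R u x" and w: "\<not> ksat W R V \<phi> w"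
      using finite_countermodel[of \<phi>] by blast
    have "W \<noteq> {}" using W(2) by blast
    then obtain \<pi> :: "'a \<Rightarrow> 'p fm set" where
      \<pi>: "range \<pi> \<subseteq> W" "\<forall>w\<in>W. infinite (\<pi> -` {w})"
      using infinite_fibre_map[OF inf W(1)] by blast
    let ?T = "spread_topology \<pi> R"
    have "ns_valid ?T (M ?T) \<phi>" using valid inf by (simp add: topspace_spread)
    then have "{a. ksat W R V \<phi> (\<pi> a)} = UNIV"
      using extent_spread[OF assms trans \<pi>, of V \<phi>] by (simp add: ns_valid_def topspace_spread)
    moreover have "\<pi> -` {w} \<noteq> {}" using \<pi>(2) W(2) by (metis finite.emptyI)
    ultimately show False using w by blast
  qed
qed

end
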